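(* Let $R$ be a Bézout ring. Then the following are equivalent: (1) $R$ is feckly zero-adequate. (2) Whenever $a,b\in R$ satisfy $aR+bR=R$, there exists an element $e\in R$ such that $a+be\in U(R)$, $aR\cap eR\subseteq J(R)$ and $e-e^2\in J(R)$. (3) For any $a\in R$, there exists an element $e\in R$ such that $a-e\in U(R)$, $aR\cap eR\subseteq J(R)$ and $e-e^2\in J(R)$.
   Context: All rings are commutative with identity. $J(R)$ denotes the Jacobson radical of $R$ and $U(R)$ the set of units of $R$. A ring is a Bézout ring if every finitely generated ideal is principal. An element $c\in R$ is feckly adequate if for every $a\in R$ there exist $r,s\in R$ such that (i) $c\equiv rs \pmod{J(R)}$; (ii) $rR+aR=R$; (iii) $s'R+aR\neq R$ for each non-invertible divisor $s'$ of $s$ (i.e. each non-unit $s'\in R$ with $s\in s'R$). A feckly zero-adequate ring is a Bézout ring $R$ in which $0\in R$ is feckly adequate. *)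

theory Defs
  imports "HOL-Algebra.Algebra"
begin

text \<open>Rings are modelled by the locale \<^locale>\<open>cring\<close>, which does not require
  \<open>\<zero> \<noteq> \<one>\<close>, so the zero ring is included. The principal ideal \<open>aR\<close> is \<open>PIdl a\<close>.\<close>

locale bezout_ring = cring +
  assumes fin_gen_principal:
    "\<lbrakk>finite A; A \<subseteq> carrier R\<rbrakk> \<Longrightarrow> principalideal (Idl A) R"

text \<open>The intersection is taken inside the carrier, so the radical of the zero ring
  (which has no maximal ideals) is the whole ring.\<close>

definition jacobson_radical :: "('a, 'b) ring_scheme \<Rightarrow> 'a set"
  where "jacobson_radical R = {x \<in> carrier R. \<forall>M. maximalideal M R \<longrightarrow> x \<in> M}"

definition feckly_adequate :: "('a, 'b) ring_scheme \<Rightarrow> 'a \<Rightarrow> bool"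
  where "feckly_adequate R c \<longleftrightarrow>
    (\<forall>a \<in> carrier R. \<exists>r \<in> carrier R. \<exists>s \<in> carrier R.
      c \<ominus>\<^bsub>R\<^esub> r \<otimes>\<^bsub>R\<^esub> s \<in> jacobson_radical R \<and>
      PIdl\<^bsub>R\<^esub> r <+>\<^bsub>R\<^esub> PIdl\<^bsub>R\<^esub> a = carrier R \<and>
      (\<forall>s' \<in> carrier R. s' \<notin> Units R \<and> s' divides\<^bsub>R\<^esub> s \<longrightarrow>
        PIdl\<^bsub>R\<^esub> s' <+>\<^bsub>R\<^esub> PIdl\<^bsub>R\<^esub> a \<noteq> carrier R))"

definition feckly_zero_adequate_ring :: "('a, 'b) ring_scheme \<Rightarrow> bool"
  where "feckly_zero_adequate_ring R \<longleftrightarrow> bezout_ring R \<and> feckly_adequate R \<zero>\<^bsub>R\<^esub>"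

end

theory Submission
  imports Defs
begin

text \<open>Units, comaximality and membership in the Jacobson radical can all be tested at the maximal
  ideals: modulo \<open>J(R)\<close>, an idempotent \<open>e\<close> is a choice, at each maximal ideal \<open>M\<close>, between \<open>e \<in> M\<close>
  and \<open>1 - e \<in> M\<close>. A decomposition \<open>0 \<equiv> r s\<close> with \<open>r\<close> comaximal to \<open>a\<close> and \<open>s\<close> as in
  the definition of feckly adequate makes \<open>gcd r s\<close> a unit, so \<open>r x + s y = 1\<close>, and \<open>e = r x\<close> is the
  required idempotent. Conversely \<open>r = e\<close>, \<open>s = 1 - e\<close> is such a decomposition.\<close>

section \<open>Maximal ideals and containment of ideals\<close>

text \<open>Zorn's lemma applied to the proper ideals above \<open>I\<close>: the union of a chain
  of them is again an ideal, and it stays proper because no member contains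
  \<open>\<one>\<close>.\<close>

lemma (in ring) exists_maximalideal:
  assumes I: "ideal I R" "I \<noteq> carrier R"
  obtains M where "maximalideal M R" "I \<subseteq> M"
proof -
  define A where "A = {K. ideal K R \<and> I \<subseteq> K \<and> K \<noteq> carrier R}"
  have "\<exists>M\<in>A. \<forall>J\<in>A. M \<subseteq> J \<longrightarrow> J = M"
  proof (rule subset_Zorn_nonempty)
    show "A \<noteq> {}" using I by (auto simp: A_def)
  next
    fix C assume C: "C \<noteq> {}" "subset.chain A C"
    then have CA: "C \<subseteq> A" by (simp add: subset_chain_def)
    have "subset.chain {J. ideal J R} C"
      using C(2) by (auto simp: subset_chain_def A_def)
    then have "ideal (\<Union>C) R" using chain_Union_is_ideal[of C] C(1) by simp
    moreover have "\<one> \<notin> J" if "J \<in> C" for J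
      using that CA ideal.one_imp_carrier[of J R] by (auto simp: A_def)
    moreover have "I \<subseteq> \<Union>C" using C(1) CA by (auto simp: A_def)
    ultimately show "\<Union>C \<in> A" unfolding A_def using one_closed by blast
  qed
  then obtain M where M: "M \<in> A" and max: "\<forall>J\<in>A. M \<subseteq> J \<longrightarrow> J = M" ..
  show ?thesis
  proof (rule that[OF maximalidealI])
    show "ideal M R" "carrier R \<noteq> M" "I \<subseteq> M" using M by (simp_all add: A_def eq_commute)
  next
    fix J assume J: "ideal J R" "M \<subseteq> J"
    have "I \<subseteq> J" using M J(2) by (auto simp: A_def)
    then show "J = M \<or> J = carrier R" using max J by (auto simp: A_def)
  qed
qed

lemma (in cring) maximalideal_one_notin:
  assumes "maximalideal M R"
  shows "\<one> \<notin> M"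
  using assms ideal.one_imp_carrier maximalideal.I_notcarr maximalideal.axioms(1) by blast

lemma (in cring) maximalideal_mult_iff:
  assumes "maximalideal M R" "a \<in> carrier R" "b \<in> carrier R"
  shows "a \<otimes> b \<in> M \<longleftrightarrow> a \<in> M \<or> b \<in> M"
  using assms primeideal.I_prime[OF maximalideal_prime]
  by (meson ideal.I_l_closed ideal.I_r_closed maximalideal.axioms(1))

lemma (in cring) cgenideal_subset_iff:
  assumes "ideal I R" "a \<in> carrier R"
  shows "PIdl a \<subseteq> I \<longleftrightarrow> a \<in> I"
  using assms cgenideal_minimal cgenideal_self by blast

text \<open>The sum \<open>I <+> J\<close> is the ideal generated by the union of \<open>I\<close>
  and \<open>J\<close>.\<close>

lemma (in ring) set_add_subset_iff:
  assumes "ideal I R" "ideal J R" "ideal K R"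
  shows "I <+> J \<subseteq> K \<longleftrightarrow> I \<subseteq> K \<and> J \<subseteq> K"
proof
  assume "I <+> J \<subseteq> K"
  moreover have "I \<union> J \<subseteq> Idl (I \<union> J)"
    using assms by (intro genideal_self) (auto dest: ideal.Icarr)
  ultimately show "I \<subseteq> K \<and> J \<subseteq> K"
    using union_genideal[OF assms(1,2)] by auto
next
  assume "I \<subseteq> K \<and> J \<subseteq> K"
  then show "I <+> J \<subseteq> K"
    using union_genideal[OF assms(1,2)] genideal_minimal[OF assms(3), of "I \<union> J"] by simp
qed

lemma (in cring) cgenideal_add_subset_iff:
  assumes "ideal I R" "a \<in> carrier R" "b \<in> carrier R"
  shows "PIdl a <+> PIdl b \<subseteq> I \<longleftrightarrow> a \<in> I \<and> b \<in> I"
  using assms by (simp add: set_add_subset_iff cgenideal_ideal cgenideal_subset_iff)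

section \<open>Tests at the maximal ideals\<close>

text \<open>Every proper ideal lies below a maximal one. Applied to \<open>PIdl a\<close> this
  yields the test for units, applied to a sum of two principal ideals the test for comaximality. In
  the zero ring both sides hold, as there are no maximal ideals.\<close>

lemma (in ring) ideal_eq_carrier_iff_maximalideal:
  assumes "ideal I R"
  shows "I = carrier R \<longleftrightarrow> (\<forall>M. maximalideal M R \<longrightarrow> \<not> I \<subseteq> M)"
proof
  assume "I = carrier R"
  then show "\<forall>M. maximalideal M R \<longrightarrow> \<not> I \<subseteq> M"
    by (metis additive_subgroup.a_subset ideal.axioms(1) maximalideal.I_notcarr
        maximalideal.axioms(1) subset_antisym)
next
  assume "\<forall>M. maximalideal M R \<longrightarrow> \<not> I \<subseteq> M"
  then show "I = carrier R" using exists_maximalideal[OF assms] by blast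
qed

lemma (in cring) Units_iff_maximalideal:
  assumes "a \<in> carrier R"
  shows "a \<in> Units R \<longleftrightarrow> (\<forall>M. maximalideal M R \<longrightarrow> a \<notin> M)"
  using ideal_eq_carrier_iff[OF assms] ideal_eq_carrier_iff_maximalideal[OF cgenideal_ideal[OF assms]]
    cgenideal_subset_iff[OF _ assms] maximalideal.axioms(1) by blast

lemma (in cring) comaximal_iff_maximalideal:
  assumes "a \<in> carrier R" "b \<in> carrier R"
  shows "PIdl a <+> PIdl b = carrier R \<longleftrightarrow> (\<forall>M. maximalideal M R \<longrightarrow> a \<notin> M \<or> b \<notin> M)"
  using ideal_eq_carrier_iff_maximalideal[OF add_ideals[OF assms[THEN cgenideal_ideal]]]
    cgenideal_add_subset_iff[OF _ assms] maximalideal.axioms(1) by blast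

lemma (in cring) comaximalE:
  assumes "PIdl a <+> PIdl b = carrier R" "a \<in> carrier R" "b \<in> carrier R"
  obtains x y where "x \<in> carrier R" "y \<in> carrier R" "a \<otimes> x \<oplus> b \<otimes> y = \<one>"
proof -
  have "\<one> \<in> PIdl a <+> PIdl b" using assms(1) by simp
  then obtain x y where "x \<in> carrier R" "y \<in> carrier R" "\<one> = x \<otimes> a \<oplus> y \<otimes> b"
    by (auto simp: set_add_def' cgenideal_def)
  then show ?thesis using assms(2,3) by (intro that[of x y]) (auto simp: m_comm)
qed

lemma (in cring) cgenideal_Int_subset_jacobson_radical_iff:
  assumes "a \<in> carrier R" "b \<in> carrier R"
  shows "PIdl a \<inter> PIdl b \<subseteq> jacobson_radical R \<longleftrightarrow>
    (\<forall>M. maximalideal M R \<longrightarrow> a \<in> M \<or> b \<in> M)"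
proof
  assume *: "PIdl a \<inter> PIdl b \<subseteq> jacobson_radical R"
  \<comment> \<open>The product lies in both principal ideals, hence in every maximal ideal, and
    maximal ideals are prime.\<close>
  have "a \<otimes> b \<in> PIdl a" using assms m_comm[OF assms] unfolding cgenideal_def by blast
  moreover have "a \<otimes> b \<in> PIdl b" using assms unfolding cgenideal_def by blast
  ultimately show "\<forall>M. maximalideal M R \<longrightarrow> a \<in> M \<or> b \<in> M"
    using * assms maximalideal_mult_iff unfolding jacobson_radical_def by blast
next
  assume *: "\<forall>M. maximalideal M R \<longrightarrow> a \<in> M \<or> b \<in> M"
  show "PIdl a \<inter> PIdl b \<subseteq> jacobson_radical R"
  proof
    fix z assume z: "z \<in> PIdl a \<inter> PIdl b"
    then have "z \<in> carrier R" using assms by (auto simp: cgenideal_def)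
    moreover have "z \<in> M" if "maximalideal M R" for M
      using * that z assms cgenideal_subset_iff[of M] maximalideal.axioms(1) by blast
    ultimately show "z \<in> jacobson_radical R" by (simp add: jacobson_radical_def)
  qed
qed

lemma (in cring) mult_in_jacobson_radical_iff:
  assumes "a \<in> carrier R" "b \<in> carrier R"
  shows "a \<otimes> b \<in> jacobson_radical R \<longleftrightarrow> (\<forall>M. maximalideal M R \<longrightarrow> a \<in> M \<or> b \<in> M)"
  using assms maximalideal_mult_iff unfolding jacobson_radical_def by auto

lemma (in cring) idempotent_mod_jacobson_radical_iff:
  assumes "e \<in> carrier R"
  shows "e \<ominus> e \<otimes> e \<in> jacobson_radical R \<longleftrightarrow>
    (\<forall>M. maximalideal M R \<longrightarrow> e \<in> M \<or> \<one> \<ominus> e \<in> M)"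
proof -
  have "e \<ominus> e \<otimes> e = e \<otimes> (\<one> \<ominus> e)" using assms by algebra
  then show ?thesis using assms by (simp add: mult_in_jacobson_radical_iff)
qed

lemma (in cring) minus_in_jacobson_radical_iff:
  assumes "x \<in> carrier R"
  shows "\<ominus> x \<in> jacobson_radical R \<longleftrightarrow> x \<in> jacobson_radical R"
proof -
  have "\<ominus> x \<in> M \<longleftrightarrow> x \<in> M" if "maximalideal M R" for M
    using assms that additive_subgroup.a_inv_closed ideal.axioms(1) maximalideal.axioms(1)
      minus_minus by metis
  then show ?thesis using assms by (auto simp: jacobson_radical_def)
qed

text \<open>Each clause of the definition is replaced by its test at the maximal ideals; the sign in
  \<open>\<zero> \<ominus> r \<otimes> s\<close> does not affect membership in the radical. The
  clause on non-unit divisors is contraposed so that it can be used to produce units.\<close>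

lemma (in cring) feckly_adequate_zero_iff:
  "feckly_adequate R \<zero> \<longleftrightarrow> (\<forall>a \<in> carrier R. \<exists>r \<in> carrier R. \<exists>s \<in> carrier R.
    (\<forall>M. maximalideal M R \<longrightarrow> r \<in> M \<or> s \<in> M) \<and> (\<forall>M. maximalideal M R \<longrightarrow> r \<notin> M \<or> a \<notin> M) \<and>
    (\<forall>d \<in> carrier R. d divides s \<and> (\<forall>M. maximalideal M R \<longrightarrow> d \<notin> M \<or> a \<notin> M) \<longrightarrow> d \<in> Units R))"
proof -
  have "\<zero> \<ominus> r \<otimes> s \<in> jacobson_radical R \<longleftrightarrow> (\<forall>M. maximalideal M R \<longrightarrow> r \<in> M \<or> s \<in> M)"
    if "r \<in> carrier R" "s \<in> carrier R" for r s
    using that minus_in_jacobson_radical_iff mult_in_jacobson_radical_iff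
    by (simp add: minus_eq)
  then show ?thesis
    unfolding feckly_adequate_def
    by (intro ball_cong bex_cong refl) (auto simp: comaximal_iff_maximalideal)
qed

section \<open>Greatest common divisors and comaximality in a Bezout ring\<close>

text \<open>The gcd is a generator of the principal ideal \<open>Idl {a, b}\<close>, which equals
  the sum of the two principal ideals; containment of principal ideals is divisibility.\<close>

lemma (in bezout_ring) gcd_exists:
  assumes "a \<in> carrier R" "b \<in> carrier R"
  obtains d where "d \<in> carrier R" "d divides a" "d divides b" "PIdl d = PIdl a <+> PIdl b"
proof -
  have sub: "{a, b} \<subseteq> carrier R" using assms by simp
  obtain d where d: "d \<in> carrier R" "Idl {a, b} = PIdl d"
    using principalideal.generate[OF fin_gen_principal[OF _ sub]] cgenideal_eq_genideal by auto
  have "a \<in> PIdl d" "b \<in> PIdl d" using genideal_self[OF sub] d(2) by auto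
  then have le: "PIdl a \<subseteq> PIdl d" "PIdl b \<subseteq> PIdl d"
    using assms cgenideal_subset_iff[OF cgenideal_ideal[OF d(1)]] by auto
  have sum: "ideal (PIdl a <+> PIdl b) R" using assms by (intro add_ideals cgenideal_ideal)
  then have "PIdl d \<subseteq> PIdl a <+> PIdl b"
    using genideal_minimal[OF sum, of "{a, b}"] cgenideal_add_subset_iff[OF sum assms] d(2) by simp
  moreover have "PIdl a <+> PIdl b \<subseteq> PIdl d"
    using le assms d(1) by (simp add: set_add_subset_iff cgenideal_ideal)
  ultimately show ?thesis
    using le assms d(1) by (intro that[of d]) (simp_all add: to_contain_is_to_divide[symmetric])
qed

text \<open>The gcd of \<open>s\<close> and \<open>m\<close> is a divisor of \<open>s\<close> comaximal to \<open>a\<close>, hence a unit.\<close>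

lemma (in bezout_ring) comaximal_if_divisors_units:
  assumes carr: "a \<in> carrier R" "s \<in> carrier R" "m \<in> carrier R"
    and div: "\<And>d. \<lbrakk>d \<in> carrier R; d divides s; \<And>M. maximalideal M R \<Longrightarrow> d \<notin> M \<or> a \<notin> M\<rbrakk>
      \<Longrightarrow> d \<in> Units R"
    and ma: "\<And>M. maximalideal M R \<Longrightarrow> m \<notin> M \<or> a \<notin> M"
  shows "PIdl s <+> PIdl m = carrier R"
proof -
  obtain d where d: "d \<in> carrier R" "d divides s" "PIdl d = PIdl s <+> PIdl m"
    using gcd_exists[OF carr(2,3)] .
  have "d \<in> Units R"
  proof (rule div[OF d(1,2)])
    fix M assume M: "maximalideal M R"
    have "d \<in> M \<Longrightarrow> m \<in> M"
      using cgenideal_add_subset_iff[OF maximalideal.axioms(1)[OF M] carr(2,3)]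
        cgenideal_subset_iff[OF maximalideal.axioms(1)[OF M] d(1)] d(3) by simp
    with ma[OF M] show "d \<notin> M \<or> a \<notin> M" by blast
  qed
  then show ?thesis using ideal_eq_carrier_iff[OF d(1)] d(3) by simp
qed

section \<open>Idempotents modulo the radical from adequacy of zero, and back\<close>

text \<open>The element \<open>e\<close> is built from \<open>a\<close> alone, so the same
  \<open>e\<close> serves every \<open>b\<close> comaximal to \<open>a\<close> in condition
  (2).\<close>

lemma (in bezout_ring) feckly_adequate_zero_imp_idempotent:
  assumes "feckly_adequate R \<zero>" "a \<in> carrier R"
  obtains e where "e \<in> carrier R"
    "\<And>M. maximalideal M R \<Longrightarrow> (a \<in> M \<and> e \<notin> M) \<or> (a \<notin> M \<and> e \<in> M)"
    "e \<ominus> e \<otimes> e \<in> jacobson_radical R"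
proof -
  obtain r s where rs: "r \<in> carrier R" "s \<in> carrier R"
    and rs0: "\<And>M. maximalideal M R \<Longrightarrow> r \<in> M \<or> s \<in> M"
    and ra: "\<And>M. maximalideal M R \<Longrightarrow> r \<notin> M \<or> a \<notin> M"
    and div: "\<And>d. \<lbrakk>d \<in> carrier R; d divides s; \<And>M. maximalideal M R \<Longrightarrow> d \<notin> M \<or> a \<notin> M\<rbrakk>
      \<Longrightarrow> d \<in> Units R"
    using assms(1)[unfolded feckly_adequate_zero_iff, THEN bspec, OF assms(2)]
    by (elim bexE conjE) (rule that; blast)
  have "PIdl s <+> PIdl r = carrier R"
    using comaximal_if_divisors_units[OF assms(2) rs(2,1) div ra] .
  then obtain y x where xy: "x \<in> carrier R" "y \<in> carrier R" "s \<otimes> y \<oplus> r \<otimes> x = \<one>"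
    using comaximalE rs by metis
  define e where "e = r \<otimes> x"
  have e: "e \<in> carrier R" using rs xy by (simp add: e_def)
  have one_minus: "\<one> \<ominus> e = s \<otimes> y"
    unfolding e_def xy(3)[symmetric] using rs xy(1,2) by algebra
  \<comment> \<open>If \<open>e\<close> is in \<open>M\<close>, then its complement
    \<open>s \<otimes> y\<close> is not, so \<open>s\<close> is outside \<open>M\<close> and
    \<open>rs0\<close> leaves only \<open>r\<close>.\<close>
  have er: "e \<in> M \<longleftrightarrow> r \<in> M" if M: "maximalideal M R" for M
  proof
    assume "e \<in> M"
    then have "s \<otimes> y \<notin> M"
      using additive_subgroup.a_closed[OF ideal.axioms(1)[OF maximalideal.axioms(1)[OF M]]]
        xy(3) maximalideal_one_notin[OF M] e_def by metis
    then show "r \<in> M" using rs0[OF M] M rs xy by (simp add: maximalideal_mult_iff)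
  qed (use M rs xy in \<open>simp add: e_def maximalideal_mult_iff\<close>)
  \<comment> \<open>If \<open>M\<close> missed both, maximality would give
    \<open>\<one> = t \<otimes> a \<oplus> m\<close> with \<open>m\<close> in \<open>M\<close>. This
    \<open>m\<close> is comaximal to \<open>a\<close>, hence also to \<open>s\<close>, so
    \<open>s\<close> is outside \<open>M\<close>. Then \<open>r\<close>, and with it
    \<open>e\<close>, lies in \<open>M\<close>, a contradiction.\<close>
  have ae: "a \<in> M \<or> e \<in> M" if M: "maximalideal M R" for M
  proof (rule ccontr)
    assume neg: "\<not> (a \<in> M \<or> e \<in> M)"
    interpret M: maximalideal M R by (rule M)
    have idM: "ideal (PIdl a <+> M) R"
      using assms(2) by (intro add_ideals cgenideal_ideal M.is_ideal)
    have "a \<in> PIdl a <+> M" "M \<subseteq> PIdl a <+> M"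
      using set_add_subset_iff[OF cgenideal_ideal[OF assms(2)] M.is_ideal idM]
        cgenideal_self[OF assms(2)] by auto
    then have "PIdl a <+> M = carrier R"
      using M.I_maximal[OF idM] neg ideal.Icarr[OF idM] by blast
    then have "\<one> \<in> PIdl a <+> M" by simp
    then obtain t m where t: "t \<in> carrier R" "m \<in> M" "\<one> = t \<otimes> a \<oplus> m"
      by (auto simp: set_add_def' cgenideal_def)
    have m: "m \<in> carrier R" using t(2) by (rule M.Icarr)
    have "m \<notin> N \<or> a \<notin> N" if N: "maximalideal N R" for N
      using maximalideal_one_notin[OF N] t(1,3) ideal.I_l_closed[OF maximalideal.axioms(1)[OF N]]
        additive_subgroup.a_closed[OF ideal.axioms(1)[OF maximalideal.axioms(1)[OF N]]] by metis
    then have "PIdl s <+> PIdl m = carrier R"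
      using comaximal_if_divisors_units[OF assms(2) rs(2) m div] by blast
    then have "s \<notin> M" using t(2) M rs m by (auto simp: comaximal_iff_maximalideal)
    then show False using rs0[OF M] er[OF M] neg by blast
  qed
  \<comment> \<open>The factors \<open>e = r \<otimes> x\<close> and
    \<open>\<one> \<ominus> e = s \<otimes> y\<close> inherit from \<open>r\<close> and
    \<open>s\<close> that each maximal ideal contains one of them.\<close>
  have "e \<ominus> e \<otimes> e \<in> jacobson_radical R"
    using e rs xy er rs0 by (auto simp: idempotent_mod_jacobson_radical_iff one_minus maximalideal_mult_iff)
  then show ?thesis using that[of e] e ae er ra by blast
qed

lemma (in cring) feckly_adequate_zeroI:
  assumes "\<And>a. a \<in> carrier R \<Longrightarrow> \<exists>e \<in> carrier R. a \<ominus> e \<in> Units R \<and>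
    PIdl a \<inter> PIdl e \<subseteq> jacobson_radical R \<and> e \<ominus> e \<otimes> e \<in> jacobson_radical R"
  shows "feckly_adequate R \<zero>"
  unfolding feckly_adequate_zero_iff
proof
  fix a assume a: "a \<in> carrier R"
  obtain e where e: "e \<in> carrier R" and u: "a \<ominus> e \<in> Units R"
    and ae: "\<And>M. maximalideal M R \<Longrightarrow> a \<in> M \<or> e \<in> M"
    and idem: "\<And>M. maximalideal M R \<Longrightarrow> e \<in> M \<or> \<one> \<ominus> e \<in> M"
    using assms[OF a] a
    by (auto simp: cgenideal_Int_subset_jacobson_radical_iff idempotent_mod_jacobson_radical_iff)
  \<comment> \<open>A maximal ideal containing both would contain the unit
    \<open>a \<ominus> e\<close>.\<close>
  have ea: "e \<notin> M \<or> a \<notin> M" if M: "maximalideal M R" for M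
  proof -
    interpret M: maximalideal M R by (rule M)
    have "a \<ominus> e \<notin> M" using u M a e by (simp add: Units_iff_maximalideal)
    then show ?thesis using M.a_closed[of a "\<ominus> e"] M.a_inv_closed[of e] unfolding minus_eq by blast
  qed
  have "d \<in> Units R"
    if d: "d \<in> carrier R" "d divides (\<one> \<ominus> e)"
      and da: "\<And>M. maximalideal M R \<Longrightarrow> d \<notin> M \<or> a \<notin> M" for d
  proof -
    \<comment> \<open>If \<open>d\<close> is in \<open>M\<close>, so is its multiple
      \<open>\<one> \<ominus> e\<close>; also \<open>a\<close> is outside \<open>M\<close> by
      \<open>da\<close>, which puts \<open>e\<close> in \<open>M\<close> by \<open>ae\<close>. The
      two add up to \<open>\<one>\<close>.\<close>
    have "d \<notin> M" if M: "maximalideal M R" for M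
    proof
      assume "d \<in> M"
      interpret M: maximalideal M R by (rule M)
      have "\<one> \<ominus> e \<in> M" using d(2) \<open>d \<in> M\<close> M.I_r_closed by (auto simp: factor_def)
      moreover have "e \<in> M" using ae[OF M] da[OF M] \<open>d \<in> M\<close> by blast
      ultimately have "(\<one> \<ominus> e) \<oplus> e \<in> M" by (rule M.a_closed)
      moreover have "(\<one> \<ominus> e) \<oplus> e = \<one>" using e by algebra
      ultimately show False using maximalideal_one_notin[OF M] by simp
    qed
    then show ?thesis using d(1) by (simp add: Units_iff_maximalideal)
  qed
  then have "\<forall>d \<in> carrier R. d divides (\<one> \<ominus> e) \<and>
      (\<forall>M. maximalideal M R \<longrightarrow> d \<notin> M \<or> a \<notin> M) \<longrightarrow> d \<in> Units R"
    by blast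
  then show "\<exists>r \<in> carrier R. \<exists>s \<in> carrier R.
    (\<forall>M. maximalideal M R \<longrightarrow> r \<in> M \<or> s \<in> M) \<and> (\<forall>M. maximalideal M R \<longrightarrow> r \<notin> M \<or> a \<notin> M) \<and>
    (\<forall>d \<in> carrier R. d divides s \<and> (\<forall>M. maximalideal M R \<longrightarrow> d \<notin> M \<or> a \<notin> M) \<longrightarrow> d \<in> Units R)"
    using e ea idem by (intro bexI[of _ e] bexI[of _ "\<one> \<ominus> e"] conjI allI impI minus_closed one_closed)
qed

theorem theorem2p16:
  fixes R (structure)
  assumes "bezout_ring R"
  defines "stmt1 \<equiv> feckly_zero_adequate_ring R"
    and "stmt2 \<equiv> \<forall>a \<in> carrier R. \<forall>b \<in> carrier R. PIdl a <+> PIdl b = carrier R \<longrightarrow>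
      (\<exists>e \<in> carrier R. a \<oplus> b \<otimes> e \<in> Units R \<and>
        PIdl a \<inter> PIdl e \<subseteq> jacobson_radical R \<and> e \<ominus> e \<otimes> e \<in> jacobson_radical R)"
    and "stmt3 \<equiv> \<forall>a \<in> carrier R. \<exists>e \<in> carrier R. a \<ominus> e \<in> Units R \<and>
        PIdl a \<inter> PIdl e \<subseteq> jacobson_radical R \<and> e \<ominus> e \<otimes> e \<in> jacobson_radical R"
  shows "(stmt1 \<longleftrightarrow> stmt2) \<and> (stmt2 \<longleftrightarrow> stmt3)"
proof -
  interpret bezout_ring R by (rule assms(1))
  have "stmt2" if "stmt1"
    unfolding stmt2_def
  proof (intro ballI impI)
    fix a b assume ab: "a \<in> carrier R" "b \<in> carrier R" "PIdl a <+> PIdl b = carrier R"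
    have "feckly_adequate R \<zero>" using that by (simp add: stmt1_def feckly_zero_adequate_ring_def)
    then obtain e where e: "e \<in> carrier R"
      and ae: "\<And>M. maximalideal M R \<Longrightarrow> (a \<in> M \<and> e \<notin> M) \<or> (a \<notin> M \<and> e \<in> M)"
      and idem: "e \<ominus> e \<otimes> e \<in> jacobson_radical R"
      using feckly_adequate_zero_imp_idempotent[OF _ ab(1)] by blast
    \<comment> \<open>Exactly one of the summands lies in \<open>M\<close>: where \<open>a\<close>
      does, neither \<open>b\<close> nor \<open>e\<close> does; where \<open>a\<close> does not,
      \<open>e\<close> does. A sum in \<open>M\<close> would force both summands in or both
      out.\<close>
    have "a \<oplus> b \<otimes> e \<notin> M" if M: "maximalideal M R" for M
    proof
      assume sum: "a \<oplus> b \<otimes> e \<in> M"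
      interpret M: maximalideal M R by (rule M)
      have be: "b \<otimes> e \<in> M \<longleftrightarrow> b \<in> M \<or> e \<in> M" using maximalideal_mult_iff[OF M ab(2) e] .
      have "a = (a \<oplus> b \<otimes> e) \<oplus> \<ominus> (b \<otimes> e)" "b \<otimes> e = (a \<oplus> b \<otimes> e) \<oplus> \<ominus> a"
        using ab(1,2) e by algebra+
      then have "a \<in> M \<longleftrightarrow> b \<otimes> e \<in> M"
        using sum M.a_closed M.a_inv_closed by metis
      moreover have "a \<notin> M \<or> b \<notin> M" using ab M by (simp add: comaximal_iff_maximalideal)
      ultimately show False using be ae[OF M] by blast
    qed
    then have "a \<oplus> b \<otimes> e \<in> Units R" using ab e by (simp add: Units_iff_maximalideal)
    moreover have "PIdl a \<inter> PIdl e \<subseteq> jacobson_radical R"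
      using ab(1) e ae by (auto simp: cgenideal_Int_subset_jacobson_radical_iff)
    ultimately show "\<exists>e \<in> carrier R. a \<oplus> b \<otimes> e \<in> Units R \<and>
        PIdl a \<inter> PIdl e \<subseteq> jacobson_radical R \<and> e \<ominus> e \<otimes> e \<in> jacobson_radical R"
      using e idem by blast
  qed
  moreover have "stmt3" if "stmt2"
    unfolding stmt3_def
  proof
    fix a assume a: "a \<in> carrier R"
    \<comment> \<open>Condition (3) is condition (2) at \<open>b = \<ominus> \<one>\<close>, a unit
      and so comaximal to every \<open>a\<close>.\<close>
    have "\<ominus> \<one> \<notin> M" if M: "maximalideal M R" for M
      using maximalideal_one_notin[OF M] minus_minus[OF one_closed]
        additive_subgroup.a_inv_closed[OF ideal.axioms(1)[OF maximalideal.axioms(1)[OF M]]] by metis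
    then have "PIdl a <+> PIdl (\<ominus> \<one>) = carrier R"
      using a by (simp add: comaximal_iff_maximalideal)
    moreover have "a \<oplus> \<ominus> \<one> \<otimes> e = a \<ominus> e" if "e \<in> carrier R" for e
      using a that by algebra
    ultimately show "\<exists>e \<in> carrier R. a \<ominus> e \<in> Units R \<and>
        PIdl a \<inter> PIdl e \<subseteq> jacobson_radical R \<and> e \<ominus> e \<otimes> e \<in> jacobson_radical R"
      using \<open>stmt2\<close> a unfolding stmt2_def by (metis a_inv_closed one_closed)
  qed
  moreover have "stmt1" if "stmt3"
    using that feckly_adequate_zeroI assms(1)
    by (simp add: stmt1_def stmt3_def feckly_zero_adequate_ring_def)
  ultimately show ?thesis by blast
qed

end
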